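(* Let $(X,\|\cdot\|)$ be a Banach space, $J:X\to X$ a nonexpansive mapping, and $\Phi(\lambda,x)=\lambda J\left(\frac{1-\lambda}{\lambda}x\right)$ for $\lambda\in(0,1]$, $x\in X$. Assume there is a constant $C$ such that $$\|\Phi(\lambda,x)-\Phi(\mu,x)\|\le|\lambda-\mu|\,(C+\|x\|)\qquad\forall x\in X,\ \forall(\lambda,\mu)\in(0,1]^2 .$$ Let $u_0\in X$ and, for $\alpha\in[0,1)$, let $u^\alpha$ be the solution on $[0,+\infty)$ of $$u(t)+u'(t)=\Phi\left((1+t)^{\alpha-1},u(t)\right),\qquad u(0)=u_0 .$$ Let $l\in X$. Then: (1) $u^0(t)$ converges to $l$ as $t\to+\infty$ if and only if $v_n$ converges to $l$ as $n\to+\infty$; (2) for every $\alpha\in(0,1)$, $u^\alpha(t)$ converges to $l$ as $t\to+\infty$ if and only if $v_\lambda$ converges to $l$ as $\lambda\to0$.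
   Context: $J$ nonexpansive means $\|J(x)-J(y)\|\le\|x-y\|$ for all $x,y\in X$. $v_n=\frac{J^n(0)}{n}$ for $n\ge1$, where $J^n$ is the $n$-fold composition of $J$. For $\lambda\in(0,1]$, the map $\Phi(\lambda,\cdot)$ is $(1-\lambda)$-Lipschitz and $v_\lambda$ denotes its unique fixed point: $v_\lambda=\Phi(\lambda,v_\lambda)$. Convergence is in norm. Each Cauchy problem has a unique solution on $[0,+\infty)$. *)

theory Defs
  imports "HOL-Analysis.Analysis"
begin

definition Phi :: "('a::real_normed_vector \<Rightarrow> 'a) \<Rightarrow> real \<Rightarrow> 'a \<Rightarrow> 'a" where
  "Phi J lam x = lam *\<^sub>R J (((1 - lam) / lam) *\<^sub>R x)"

definition v_iter :: "('a::real_normed_vector \<Rightarrow> 'a) \<Rightarrow> nat \<Rightarrow> 'a" where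
  "v_iter J n = (1 / real n) *\<^sub>R (J ^^ n) 0"

text \<open>Meaningful only for \<open>0 < lam \<le> 1\<close>; see \<open>Phi_unique_fixpoint\<close> below.\<close>

definition v_disc :: "('a::real_normed_vector \<Rightarrow> 'a) \<Rightarrow> real \<Rightarrow> 'a" where
  "v_disc J lam = (THE v. v = Phi J lam v)"

text \<open>The derivative at \<open>0\<close> is one-sided. Since the right-hand side of the equation is continuous,
  a differentiable solution is automatically continuously differentiable.\<close>

definition solves_cauchy ::
    "('a::real_normed_vector \<Rightarrow> 'a) \<Rightarrow> real \<Rightarrow> 'a \<Rightarrow> (real \<Rightarrow> 'a) \<Rightarrow> bool" where
  "solves_cauchy J \<alpha> u0 u \<longleftrightarrow> u 0 = u0 \<and>
     (\<exists>u'. \<forall>t\<ge>0. (u has_vector_derivative u' t) (at t within {0..}) \<and>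
                  u t + u' t = Phi J ((1 + t) powr (\<alpha> - 1)) (u t))"

lemma Phi_lipschitz:
  assumes J: "1-lipschitz_on UNIV J" and l: "0 < lam" "lam \<le> 1"
  shows "(1 - lam)-lipschitz_on UNIV (Phi J lam)"
proof (rule lipschitz_onI)
  fix x y :: 'a
  let ?c = "(1 - lam) / lam"
  have "dist (Phi J lam x) (Phi J lam y) = lam * dist (J (?c *\<^sub>R x)) (J (?c *\<^sub>R y))"
    using l by (simp add: Phi_def dist_norm flip: scaleR_diff_right)
  also have "\<dots> \<le> lam * dist (?c *\<^sub>R x) (?c *\<^sub>R y)"
    using lipschitz_onD[OF J, of "?c *\<^sub>R x" "?c *\<^sub>R y"] l by simp
  also have "\<dots> = (1 - lam) * dist x y"
    using l by (simp add: dist_norm flip: scaleR_diff_right)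
  finally show "dist (Phi J lam x) (Phi J lam y) \<le> (1 - lam) * dist x y" .
qed (use l in simp)

lemma Phi_unique_fixpoint:
  fixes J :: "'a::banach \<Rightarrow> 'a"
  assumes J: "1-lipschitz_on UNIV J" and l: "0 < lam" "lam \<le> 1"
  shows "\<exists>!v. v = Phi J lam v"
proof -
  have "\<exists>!v. Phi J lam v = v"
    using banach_fix_type[of "1 - lam" "Phi J lam"] lipschitz_onD[OF Phi_lipschitz[OF J l]] l
    by simp
  then show ?thesis by (simp add: eq_commute)
qed

lemma v_disc_fixpoint:
  fixes J :: "'a::banach \<Rightarrow> 'a"
  assumes "1-lipschitz_on UNIV J" "0 < lam" "lam \<le> 1"
  shows "v_disc J lam = Phi J lam (v_disc J lam)"
  unfolding v_disc_def by (rule theI'[OF Phi_unique_fixpoint[OF assms]])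

end

theory Submission
  imports Defs "HOL-Real_Asymp.Real_Asymp"
begin

text \<open>
  Along a solution of \<open>u + u' = p\<close>, the distance to a constant vector \<open>z\<close> has upper right slope
  at most \<open>norm (p - z) - norm (u - z)\<close>. Both parts of the theorem compare such a distance with
  an explicit function that is a supersolution of the resulting differential inequality
  (\<open>norm_right_slope\<close>, \<open>comparison_right_slope\<close>).

  For \<open>0 < \<alpha> < 1\<close> put \<open>lam t = (1 + t) powr (\<alpha> - 1)\<close> and let \<open>f\<close> be the distance between the solution and
  \<open>v_disc J (lam t)\<close>. The contraction rate of \<open>Phi J (lam t)\<close> and the hypothesis on \<open>Phi\<close> give
  \<open>f' \<le> - lam f + K / (1 + t)\<close>. Since \<open>lam\<close> has infinite integral and \<open>1 / (1 + t)\<close> is negligible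
  with respect to \<open>lam t\<close>, \<open>f\<close> tends to \<open>0\<close> (\<open>solves_cauchy_minus_v_disc\<close>).

  For \<open>\<alpha> = 0\<close> that forcing term is no longer negligible, and the solution is compared with the iterates instead.
  These satisfy \<open>v_iter J n = Phi J (1 / n) (v_iter J (n - 1))\<close>, an Euler scheme of step \<open>1\<close> for the same
  equation. With \<open>x = 1 + t\<close>, the weighted distances \<open>G n = n * norm (u t - v_iter J n)\<close> satisfy
  \<open>G n' \<le> G (n - 1) - G n + K * \<bar>n - x\<bar> / x\<close>. The function \<open>sqrt ((n - x)\<^sup>2 + x)\<close> is a supersolution of
  the equation without forcing, as in Chernoff's estimate for semigroups; multiplying it by \<open>1 + ln x\<close>
  absorbs the forcing. Hence \<open>G n\<close> is of order \<open>sqrt n * ln n\<close> when \<open>n\<close> is the integer part of \<open>t\<close>, and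
  dividing by \<open>n\<close> shows that the distance tends to \<open>0\<close> (\<open>v_iter_estimate\<close>,
  \<open>solves_cauchy_minus_v_iter\<close>).
\<close>

section \<open>Differential inequalities for right slopes\<close>

text \<open>Comparison needs control of the slope of \<open>f\<close> only to the right and only where the two functions
  meet: after their last meeting \<open>f\<close> would have to stay above \<open>y\<close>.\<close>

lemma comparison_right_slope:
  fixes f y y' :: "real \<Rightarrow> real"
  assumes cont: "continuous_on {a..} f"
    and deriv: "\<And>t. t \<ge> a \<Longrightarrow> (y has_real_derivative y' t) (at t)"
    and init: "f a \<le> y a"
    and slope: "\<And>t. t \<ge> a \<Longrightarrow> f t = y t \<Longrightarrow>
      \<exists>m<y' t. eventually (\<lambda>h. f (t + h) \<le> f t + h * m) (at_right 0)"
    and "b \<ge> a"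
  shows "f b \<le> y b"
proof (rule ccontr)
  assume "\<not> f b \<le> y b"
  then have fb: "f b > y b" by simp
  define g where "g = (\<lambda>t. f t - y t)"
  have "continuous_on {a..} y"
    by (rule DERIV_continuous_on[where D = y']) (auto intro: deriv has_field_derivative_at_within)
  then have cg: "continuous_on {a..} g"
    unfolding g_def by (intro continuous_on_diff cont)
  have zero: "\<exists>x\<ge>c. x \<le> b \<and> g x = 0" if "c \<ge> a" "c \<le> b" "g c \<le> 0" for c
    using IVT'[of g c 0 b] that fb continuous_on_subset[OF cg, of "{c..b}"] by (auto simp: g_def)
  define S where "S = {t\<in>{a..b}. g t = 0}"
  have "S \<noteq> {}"
    using zero[of a] init \<open>b \<ge> a\<close> by (auto simp: S_def g_def)
  moreover have "compact S"
  proof -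
    have "closed S"
      unfolding S_def
      by (rule continuous_closed_preimage_constant)
         (auto intro: continuous_on_subset[OF cg])
    moreover have "S = {a..b} \<inter> S" by (auto simp: S_def)
    ultimately show ?thesis by (metis compact_Icc compact_Int_closed)
  qed
  ultimately obtain s where s: "s \<in> S" and smax: "\<And>t. t \<in> S \<Longrightarrow> t \<le> s"
    using compact_attains_sup[of S] by auto
  have sab: "a \<le> s" "s \<le> b" "f s = y s" using s by (auto simp: S_def g_def)
  have "s < b" using sab fb by (cases "s = b") auto
  obtain m where m: "m < y' s" and ev: "eventually (\<lambda>h. f (s + h) \<le> f s + h * m) (at_right 0)"
    using slope[OF sab(1) sab(3)] by blast
  have "((\<lambda>h. (y (s + h) - y s) / h) \<longlongrightarrow> y' s) (at_right 0)"
    using deriv[OF sab(1)] unfolding DERIV_def by (rule tendsto_mono[rotated]) (simp add: at_le)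
  then have "eventually (\<lambda>h. (y (s + h) - y s) / h > m) (at_right 0)"
    using m by (rule order_tendstoD)
  moreover have "eventually (\<lambda>h. h \<in> {0<..<b - s}) (at_right 0)"
    using eventually_at_right_real[of 0 "b - s"] \<open>s < b\<close> by simp
  ultimately have "eventually (\<lambda>h. h \<in> {0<..<b - s} \<and> g (s + h) < 0) (at_right 0)"
    using ev
  proof eventually_elim
    case (elim h)
    then have "h * m < y (s + h) - y s" by (simp add: field_simps)
    then show ?case using elim sab by (simp add: g_def)
  qed
  then obtain h where h: "h \<in> {0<..<b - s}" "g (s + h) < 0"
    using eventually_happens'[of "at_right (0::real)"] by auto
  then obtain x where "x \<ge> s + h" "x \<le> b" "g x = 0"
    using zero[of "s + h"] sab by auto
  then show False using smax[of x] h sab by (auto simp: S_def)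
qed

text \<open>For small \<open>h\<close> the vector \<open>u (t + h)\<close> is, up to \<open>o(h)\<close>, the convex combination
  \<open>(1 - h) u t + h p\<close>.\<close>

lemma norm_right_slope:
  fixes u :: "real \<Rightarrow> 'a::real_normed_vector"
  assumes deriv: "(u has_vector_derivative p - u t) (at t within {0..})" and t: "t \<ge> 0"
    and m: "m > norm (p - z) - norm (u t - z)"
  shows "eventually (\<lambda>h. norm (u (t + h) - z) \<le> norm (u t - z) + h * m) (at_right 0)"
proof -
  define e where "e = m - (norm (p - z) - norm (u t - z))"
  have e: "e > 0" using m by (simp add: e_def)
  have "\<exists>d>0. \<forall>s\<in>{0..}. norm (s - t) < d \<longrightarrow>
      norm (u s - u t - (s - t) *\<^sub>R (p - u t)) \<le> e * norm (s - t)"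
    using deriv e unfolding has_vector_derivative_def has_derivative_within_alt by blast
  then obtain d where d: "d > 0" and *: "\<And>s. s \<ge> 0 \<Longrightarrow> norm (s - t) < d \<Longrightarrow>
      norm (u s - u t - (s - t) *\<^sub>R (p - u t)) \<le> e * norm (s - t)"
    by auto
  have "eventually (\<lambda>h. h \<in> {0<..<min d 1}) (at_right 0)"
    using eventually_at_right_real[of 0 "min d 1"] d by simp
  then show ?thesis
  proof eventually_elim
    case (elim h)
    have r: "norm (u (t + h) - u t - h *\<^sub>R (p - u t)) \<le> e * h"
      using *[of "t + h"] elim t by auto
    have "u (t + h) - z =
        (u (t + h) - u t - h *\<^sub>R (p - u t)) + ((1 - h) *\<^sub>R (u t - z) + h *\<^sub>R (p - z))"
      by (simp add: algebra_simps)
    then have "norm (u (t + h) - z) \<le> norm (u (t + h) - u t - h *\<^sub>R (p - u t))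
        + (norm ((1 - h) *\<^sub>R (u t - z)) + norm (h *\<^sub>R (p - z)))"
      by (simp only:) (intro order_trans[OF norm_triangle_ineq] add_left_mono norm_triangle_ineq)
    also have "\<dots> \<le> e * h + ((1 - h) * norm (u t - z) + h * norm (p - z))"
      using r elim by simp
    also have "\<dots> = norm (u t - z) + h * m" by (simp add: e_def algebra_simps)
    finally show ?case .
  qed
qed

section \<open>Estimates for the operators and for the solutions\<close>

lemma Phi_zero [simp]: "Phi J lam 0 = lam *\<^sub>R J 0"
  by (simp add: Phi_def)

lemma norm_Phi_diff_le:
  assumes "1-lipschitz_on UNIV J" "0 < lam" "lam \<le> 1"
  shows "norm (Phi J lam x - Phi J lam y) \<le> (1 - lam) * norm (x - y)"
  using lipschitz_onD[OF Phi_lipschitz[OF assms], of x y] by (simp add: dist_norm)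

lemma norm_Phi_le:
  assumes "1-lipschitz_on UNIV J" "0 < lam" "lam \<le> 1"
  shows "norm (Phi J lam x) \<le> (1 - lam) * norm x + lam * norm (J 0)"
  using norm_Phi_diff_le[OF assms, of x 0] norm_triangle_ineq2[of "Phi J lam x" "Phi J lam 0"] assms(2)
  by simp

lemma norm_v_disc_le:
  fixes J :: "'a::banach \<Rightarrow> 'a"
  assumes "1-lipschitz_on UNIV J" "0 < lam" "lam \<le> 1"
  shows "norm (v_disc J lam) \<le> norm (J 0)"
proof -
  have "norm (v_disc J lam) \<le> (1 - lam) * norm (v_disc J lam) + lam * norm (J 0)"
    using norm_Phi_le[OF assms, of "v_disc J lam"] v_disc_fixpoint[OF assms, symmetric] by simp
  then have "lam * norm (v_disc J lam) \<le> lam * norm (J 0)" by (simp add: algebra_simps)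
  then show ?thesis using assms by simp
qed

text \<open>The map \<open>lam \<mapsto> v_disc J lam\<close> is Lipschitz away from \<open>0\<close>; the division by \<open>lam\<close> comes from the
  contraction rate \<open>1 - lam\<close>.\<close>

lemma v_disc_diff_le:
  fixes J :: "'a::banach \<Rightarrow> 'a"
  assumes J: "1-lipschitz_on UNIV J"
    and Phi: "\<And>x lam mu. lam \<in> {0<..1} \<Longrightarrow> mu \<in> {0<..1} \<Longrightarrow>
           norm (Phi J lam x - Phi J mu x) \<le> \<bar>lam - mu\<bar> * (C + norm x)"
    and l: "lam \<in> {0<..1}" and m: "mu \<in> {0<..1}"
  shows "norm (v_disc J lam - v_disc J mu) \<le> (\<bar>C\<bar> + norm (J 0)) * (\<bar>lam - mu\<bar> / lam)"
proof -
  let ?v = "v_disc J lam" and ?w = "v_disc J mu"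
  have v: "Phi J lam ?v = ?v" and w: "Phi J mu ?w = ?w"
    using v_disc_fixpoint[OF J, of lam, symmetric] v_disc_fixpoint[OF J, of mu, symmetric] l m by auto
  have "norm (?v - ?w) = norm ((Phi J lam ?v - Phi J lam ?w) + (Phi J lam ?w - Phi J mu ?w))"
    by (simp add: v w)
  also have "\<dots> \<le> norm (Phi J lam ?v - Phi J lam ?w) + norm (Phi J lam ?w - Phi J mu ?w)"
    by (rule norm_triangle_ineq)
  also have "\<dots> \<le> (1 - lam) * norm (?v - ?w) + \<bar>lam - mu\<bar> * (C + norm ?w)"
    using norm_Phi_diff_le[OF J, of lam] Phi[OF l m] l by (intro add_mono) auto
  also have "\<bar>lam - mu\<bar> * (C + norm ?w) \<le> \<bar>lam - mu\<bar> * (\<bar>C\<bar> + norm (J 0))"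
    using norm_v_disc_le[OF J, of mu] m by (intro mult_left_mono) auto
  finally have "norm (?v - ?w) * lam \<le> (\<bar>C\<bar> + norm (J 0)) * \<bar>lam - mu\<bar>"
    by (simp add: algebra_simps)
  then show ?thesis using l by (simp add: pos_le_divide_eq)
qed

lemma solves_cauchy_deriv:
  assumes "solves_cauchy J \<alpha> u0 u" "t \<ge> 0"
  shows "(u has_vector_derivative Phi J ((1 + t) powr (\<alpha> - 1)) (u t) - u t) (at t within {0..})"
proof -
  obtain d where d: "(u has_vector_derivative d) (at t within {0..})"
    and "u t + d = Phi J ((1 + t) powr (\<alpha> - 1)) (u t)"
    using assms unfolding solves_cauchy_def by blast
  then have "d = Phi J ((1 + t) powr (\<alpha> - 1)) (u t) - u t" by (simp add: algebra_simps)
  with d show ?thesis by simp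
qed

lemma solves_cauchy_continuous:
  assumes "solves_cauchy J \<alpha> u0 u"
  shows "continuous_on {0..} u"
  by (rule continuous_on_vector_derivative) (use solves_cauchy_deriv[OF assms] in auto)

lemma powr_time_in_unit_interval:
  assumes "\<alpha> \<le> 1" "t \<ge> 0"
  shows "(1 + t) powr (\<alpha> - 1) \<in> {0<..(1::real)}"
proof -
  have "(1 + t) powr (\<alpha> - 1) \<le> (1 + t) powr 0"
    using assms by (intro powr_mono) auto
  then show ?thesis using assms by simp
qed

lemma solves_cauchy_bounded:
  fixes J :: "'a::banach \<Rightarrow> 'a"
  assumes J: "1-lipschitz_on UNIV J" and u: "solves_cauchy J \<alpha> u0 u" and "\<alpha> \<le> 1" and t: "t \<ge> 0"
  shows "norm (u t) \<le> norm u0 + norm (J 0)"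
proof (rule field_le_epsilon)
  fix e :: real assume e: "e > 0"
  show "norm (u t) \<le> norm u0 + norm (J 0) + e"
  proof (rule comparison_right_slope[where a = 0 and f = "\<lambda>t. norm (u t)" and y' = "\<lambda>_. 0"])
    show "continuous_on {0..} (\<lambda>t. norm (u t))"
      by (intro continuous_intros solves_cauchy_continuous[OF u])
    show "norm (u 0) \<le> norm u0 + norm (J 0) + e"
      using u e by (simp add: solves_cauchy_def)
  next
    fix s :: real
    assume s: "s \<ge> 0" and eq: "norm (u s) = norm u0 + norm (J 0) + e"
    define lam where "lam = (1 + s) powr (\<alpha> - 1)"
    have lam: "0 < lam" "lam \<le> 1" using powr_time_in_unit_interval[OF \<open>\<alpha> \<le> 1\<close> s] by (auto simp: lam_def)
    have "norm (Phi J lam (u s)) - norm (u s) \<le> lam * (norm (J 0) - norm (u s))"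
      using norm_Phi_le[OF J lam, of "u s"] by (simp add: algebra_simps)
    also have "\<dots> < 0"
      using lam e eq norm_ge_zero[of u0] by (intro mult_pos_neg) linarith+
    finally obtain m where m: "norm (Phi J lam (u s)) - norm (u s) < m" "m < 0"
      using dense by blast
    then show "\<exists>m<0. eventually (\<lambda>h. norm (u (s + h)) \<le> norm (u s) + h * m) (at_right 0)"
      using norm_right_slope[OF solves_cauchy_deriv[OF u s] s, where m = m and z = 0]
      by (auto simp: lam_def)
  qed (use t in auto)
qed

section \<open>The slow equations follow the fixed points\<close>

text \<open>The relative variation of \<open>(1 + t) powr (\<alpha> - 1)\<close> over \<open>[t, t + h]\<close>, bounded without
  derivatives: its product with \<open>1 + t\<close> is nondecreasing.\<close>

lemma powr_time_diff_le:
  fixes \<alpha> t h :: real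
  assumes "0 < \<alpha>" "\<alpha> < 1" "t \<ge> 0" "h \<ge> 0"
  shows "\<bar>(1 + t) powr (\<alpha> - 1) - (1 + t + h) powr (\<alpha> - 1)\<bar> / (1 + t) powr (\<alpha> - 1) \<le> h / (1 + t)"
proof -
  define a b where "a = (1 + t) powr (\<alpha> - 1)" and "b = (1 + t + h) powr (\<alpha> - 1)"
  have "a > 0" using assms by (simp add: a_def)
  have "b \<le> a" unfolding a_def b_def using assms by (intro powr_mono2') auto
  have "a * (1 + t) = (1 + t) powr \<alpha>" "b * (1 + t + h) = (1 + t + h) powr \<alpha>"
    using assms by (simp_all add: a_def b_def powr_mult_base' powr_diff)
  moreover have "(1 + t) powr \<alpha> \<le> (1 + t + h) powr \<alpha>"
    using assms by (intro powr_mono2) auto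
  ultimately have "(a - b) * (1 + t) \<le> b * h" by (simp add: algebra_simps)
  also have "\<dots> \<le> a * h" using \<open>b \<le> a\<close> assms by (intro mult_right_mono)
  finally show ?thesis
    using \<open>a > 0\<close> \<open>b \<le> a\<close> assms unfolding a_def[symmetric] b_def[symmetric] by (simp add: field_simps)
qed

lemma solves_cauchy_minus_v_disc:
  fixes J :: "'a::banach \<Rightarrow> 'a"
  assumes J: "1-lipschitz_on UNIV J"
    and Phi: "\<And>x lam mu. lam \<in> {0<..1} \<Longrightarrow> mu \<in> {0<..1} \<Longrightarrow>
           norm (Phi J lam x - Phi J mu x) \<le> \<bar>lam - mu\<bar> * (C + norm x)"
    and u: "solves_cauchy J \<alpha> u0 u" and \<alpha>: "0 < \<alpha>" "\<alpha> < 1"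
  shows "((\<lambda>t. u t - v_disc J ((1 + t) powr (\<alpha> - 1))) \<longlongrightarrow> 0) at_top"
proof -
  define K where "K = \<bar>C\<bar> + norm (J 0)"
  have K: "K \<ge> 0" by (simp add: K_def)
  define lam where "lam = (\<lambda>t. (1 + t) powr (\<alpha> - 1))"
  define w where "w = (\<lambda>t. v_disc J (lam t))"
  define f where "f = (\<lambda>t. norm (u t - w t))"
  have lam: "lam t \<in> {0<..1}" "0 < lam t" "lam t \<le> 1" if "t \<ge> 0" for t
    using powr_time_in_unit_interval[of \<alpha> t] that \<alpha> by (auto simp: lam_def)
  have wdiff: "norm (w t - w s) \<le> K * (\<bar>lam t - lam s\<bar> / lam t)" if "t \<ge> 0" "s \<ge> 0" for t s
    using v_disc_diff_le[OF J Phi lam(1)[OF that(1)] lam(1)[OF that(2)]] by (simp add: w_def K_def)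
  have "continuous_on {0..} w"
    unfolding continuous_on_def
  proof
    fix t :: real assume t: "t \<in> {0..}"
    have "isCont lam t"
      unfolding lam_def using t by (intro continuous_intros) auto
    then have "(lam \<longlongrightarrow> lam t) (at t within {0..})"
      using continuous_at_imp_continuous_at_within continuous_within by blast
    then have "((\<lambda>s. K * (\<bar>lam t - lam s\<bar> / lam t)) \<longlongrightarrow> K * (\<bar>lam t - lam t\<bar> / lam t)) (at t within {0..})"
      using lam(2)[of t] t by (intro tendsto_intros) auto
    then have "((\<lambda>s. w s - w t) \<longlongrightarrow> 0) (at t within {0..})"
    proof (rule Lim_null_comparison[rotated, OF tendsto_eq_rhs])
      show "eventually (\<lambda>s. norm (w s - w t) \<le> K * (\<bar>lam t - lam s\<bar> / lam t)) (at t within {0..})"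
        using wdiff[of t] t by (auto simp: eventually_at_filter norm_minus_commute intro!: always_eventually)
    qed simp
    then show "(w \<longlongrightarrow> w t) (at t within {0..})" by (rule LIM_zero_cancel)
  qed
  then have cf: "continuous_on {0..} f"
    unfolding f_def by (intro continuous_intros solves_cauchy_continuous[OF u])
  have slope: "eventually (\<lambda>h. f (t + h) \<le> f t + h * m) (at_right 0)"
    if t: "t \<ge> 0" and m: "m > K / (1 + t) - lam t * f t" for t m
  proof -
    have "norm (Phi J (lam t) (u t) - w t) \<le> (1 - lam t) * f t"
      using norm_Phi_diff_le[OF J lam(2,3)[OF t], of "u t" "w t"] v_disc_fixpoint[OF J lam(2,3)[OF t], symmetric]
      by (simp add: f_def w_def)
    then have "m - K / (1 + t) > norm (Phi J (lam t) (u t) - w t) - norm (u t - w t)"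
      using m by (simp add: f_def algebra_simps)
    then have "eventually (\<lambda>h. norm (u (t + h) - w t) \<le> norm (u t - w t) + h * (m - K / (1 + t))) (at_right 0)"
      unfolding lam_def by (intro norm_right_slope[OF solves_cauchy_deriv[OF u t] t])
    moreover have "eventually (\<lambda>h. h > (0::real)) (at_right 0)"
      by (simp add: eventually_at_right_less)
    ultimately show ?thesis
    proof eventually_elim
      case (elim h)
      have "norm (w t - w (t + h)) \<le> K * (h / (1 + t))"
        using wdiff[of t "t + h"] powr_time_diff_le[OF \<alpha> t, of h] elim t K
          mult_left_mono[of "\<bar>lam t - lam (t + h)\<bar> / lam t" "h / (1 + t)" K]
        by (simp add: lam_def add.assoc)
      moreover have "f (t + h) \<le> norm (u (t + h) - w t) + norm (w t - w (t + h))"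
        unfolding f_def using norm_triangle_ineq[of "u (t + h) - w t" "w t - w (t + h)"] by simp
      ultimately show ?case using elim by (simp add: f_def algebra_simps)
    qed
  qed
  have "(f \<longlongrightarrow> 0) at_top"
  proof (rule order_tendstoI)
    fix a :: real assume "a < 0"
    then show "eventually (\<lambda>t. a < f t) at_top"
      by (intro always_eventually) (auto simp: f_def intro: less_le_trans)
  next
    fix e :: real assume e: "0 < e"
    define \<delta> where "\<delta> = e / 2"
    have "((\<lambda>t. K / (1 + t) powr \<alpha>) \<longlongrightarrow> 0) at_top"
      using \<alpha> by real_asymp
    then have "eventually (\<lambda>t. K / (1 + t) powr \<alpha> < \<delta>) at_top"
      by (rule order_tendstoD(2)) (use e in \<open>simp add: \<delta>_def\<close>)
    then obtain T0 where T0: "\<And>t. t \<ge> T0 \<Longrightarrow> K / (1 + t) powr \<alpha> < \<delta>"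
      unfolding eventually_at_top_linorder by blast
    define T where "T = max 0 T0"
    have T: "T \<ge> 0" by (simp add: T_def)
    \<comment> \<open>\<open>\<Lambda>\<close> is a primitive of \<open>lam\<close>, so \<open>y\<close> solves \<open>y' = - lam * (y - \<delta>)\<close> with \<open>y T = \<delta> + f T\<close>.\<close>
    define \<Lambda> where "\<Lambda> = (\<lambda>t. (1 + t) powr \<alpha> / \<alpha>)"
    define A where "A = f T * exp (\<Lambda> T)"
    define y where "y = (\<lambda>t. \<delta> + A * exp (- \<Lambda> t))"
    have le: "f t \<le> y t" if "t \<ge> T" for t
    proof (rule comparison_right_slope[where a = T and f = f and y = y and b = t and y' = "\<lambda>t. - lam t * (y t - \<delta>)"])
      show "continuous_on {T..} f" by (rule continuous_on_subset[OF cf]) (use T in auto)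
    next
      fix s assume s: "T \<le> s"
      have "(\<Lambda> has_real_derivative lam s) (at s)"
        unfolding \<Lambda>_def lam_def using s T \<alpha> by (auto intro!: derivative_eq_intros simp: field_simps)
      then show "(y has_real_derivative - lam s * (y s - \<delta>)) (at s)"
        unfolding y_def by (auto intro!: derivative_eq_intros)
    next
      show "f T \<le> y T" using e by (simp add: y_def A_def \<delta>_def mult_exp_exp mult.assoc)
    next
      fix s assume s: "T \<le> s" and eq: "f s = y s"
      have "K / (1 + s) powr \<alpha> < \<delta>" using T0 s by (simp add: T_def)
      moreover have "lam s * (K / (1 + s) powr \<alpha>) = K / (1 + s)"
        using s T by (simp add: lam_def powr_diff)
      ultimately have "K / (1 + s) < lam s * \<delta>"
        using mult_strict_left_mono[of "K / (1 + s) powr \<alpha>" \<delta> "lam s"] lam(2)[of s] s T by simp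
      then have "K / (1 + s) - lam s * f s < - lam s * (y s - \<delta>)"
        by (simp add: eq algebra_simps)
      then obtain m where "K / (1 + s) - lam s * f s < m" "m < - lam s * (y s - \<delta>)"
        using dense by blast
      then show "\<exists>m < - lam s * (y s - \<delta>). eventually (\<lambda>h. f (s + h) \<le> f s + h * m) (at_right 0)"
        using slope[of s m] s T by auto
    qed (use that in auto)
    have "(y \<longlongrightarrow> \<delta>) at_top"
      unfolding y_def \<Lambda>_def using \<alpha> by real_asymp
    then have "eventually (\<lambda>t. y t < e) at_top"
      by (rule order_tendstoD(2)) (use e in \<open>simp add: \<delta>_def\<close>)
    then show "eventually (\<lambda>t. f t < e) at_top"
      using eventually_ge_at_top[of T] by eventually_elim (use le in force)
  qed
  then show ?thesis unfolding f_def w_def lam_def by (rule tendsto_norm_zero_cancel)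
qed

section \<open>The equation with parameter zero follows the iterates\<close>

text \<open>The size of the deviation between the discrete time \<open>n\<close> and the continuous time \<open>x\<close>. The term
  \<open>x\<close> under the root is the variance at time \<open>x\<close> of a Poisson process of rate \<open>1\<close>, whose generator
  \<open>g \<mapsto> g (n - 1) - g n\<close> governs the recursive inequality for the iterates.\<close>

definition dev :: "real \<Rightarrow> real \<Rightarrow> real" where
  "dev n x = sqrt ((n - x)\<^sup>2 + x)"

lemma dev_pos: "x > 0 \<Longrightarrow> dev n x > 0"
  by (simp add: dev_def add_nonneg_pos)

lemma abs_le_dev: "x \<ge> 0 \<Longrightarrow> \<bar>n - x\<bar> \<le> dev n x"
  unfolding dev_def by (rule real_le_rsqrt) simp

lemma dev_deriv:
  assumes "x > 0"
  shows "(dev n has_real_derivative (1 - 2 * (n - x)) / (2 * dev n x)) (at x)"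
proof -
  have "(n - x)\<^sup>2 + x > 0" using assms by (simp add: add_nonneg_pos)
  then show ?thesis
    unfolding dev_def by (auto intro!: derivative_eq_intros simp: field_simps)
qed

text \<open>The right-hand side is the derivative of \<open>dev n\<close> at \<open>x\<close>. With \<open>D\<close> the deviation and \<open>d\<close> that
  derivative, \<open>(dev (n - 1) x)\<^sup>2 = D\<^sup>2 + 2 * D * d \<le> (D + d)\<^sup>2\<close>.\<close>

lemma dev_step:
  assumes "x > 0"
  shows "dev (n - 1) x - dev n x \<le> (1 - 2 * (n - x)) / (2 * dev n x)"
proof -
  define D where "D = dev n x"
  define d where "d = (1 - 2 * (n - x)) / (2 * D)"
  have D: "D > 0" using dev_pos[OF assms] by (simp add: D_def)
  have D2: "D\<^sup>2 = (n - x)\<^sup>2 + x" using assms by (simp add: D_def dev_def)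
  have dD: "2 * D * d = 1 - 2 * (n - x)" using D by (simp add: d_def)
  have "(dev (n - 1) x)\<^sup>2 = (n - 1 - x)\<^sup>2 + x" using assms by (simp add: dev_def)
  also have "\<dots> = D\<^sup>2 + 2 * D * d" unfolding D2 dD by (simp add: power2_eq_square algebra_simps)
  also have "\<dots> \<le> (D + d)\<^sup>2" by (simp add: power2_sum)
  finally have sq: "(dev (n - 1) x)\<^sup>2 \<le> (D + d)\<^sup>2" .
  have "D\<^sup>2 + 2 * D * d \<ge> 0" 
    using \<open>(n - 1 - x)\<^sup>2 + x = D\<^sup>2 + 2 * D * d\<close> assms by (metis add_nonneg_nonneg less_imp_le zero_le_power2)
  then have "D * (D + 2 * d) \<ge> 0" by (simp add: power2_eq_square algebra_simps)
  then have "D + 2 * d \<ge> 0" using D by (simp add: zero_le_mult_iff)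
  then have "D + d \<ge> 0" using D by linarith
  with sq have "dev (n - 1) x \<le> D + d" by (rule power2_le_imp_le)
  then show ?thesis by (simp add: D_def d_def)
qed

text \<open>This holds for \<open>n = 0\<close> too: \<open>v_iter J 0 = 0\<close> because \<open>1 / 0 = 0\<close>, and \<open>Phi J 1\<close> is constantly
  \<open>J 0\<close>.\<close>

lemma v_iter_Suc: "v_iter J (Suc n) = Phi J (1 / real (Suc n)) (v_iter J n)"
proof (cases "n = 0")
  case False
  then have "(1 - 1 / real (Suc n)) / (1 / real (Suc n)) = real n" by (simp add: field_simps)
  with False show ?thesis by (simp add: v_iter_def Phi_def)
qed (simp add: v_iter_def Phi_def)

lemma norm_v_iter_le:
  assumes "1-lipschitz_on UNIV J"
  shows "norm (v_iter J n) \<le> norm (J 0)"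
proof (induction n)
  case (Suc n)
  have "norm (v_iter J (Suc n)) \<le> (1 - 1 / real (Suc n)) * norm (v_iter J n) + 1 / real (Suc n) * norm (J 0)"
    unfolding v_iter_Suc by (rule norm_Phi_le[OF assms]) auto
  also have "\<dots> \<le> (1 - 1 / real (Suc n)) * norm (J 0) + 1 / real (Suc n) * norm (J 0)"
    using Suc by (intro add_mono mult_left_mono) auto
  finally show ?case by (simp add: algebra_simps)
qed (simp add: v_iter_def)

text \<open>The factor \<open>1 + ln (1 + t)\<close> is at least \<open>1\<close>, and its derivative \<open>1 / (1 + t)\<close> pays for the difference
  between the parameters \<open>1 / (1 + t)\<close> of the equation and \<open>1 / n\<close> of the iterates. The constant
  \<open>L\<close> dominates both the initial distances and the factor in the hypothesis on \<open>Phi\<close>.\<close>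

lemma v_iter_estimate:
  fixes J :: "'a::banach \<Rightarrow> 'a"
  assumes J: "1-lipschitz_on UNIV J"
    and Phi: "\<And>x lam mu. lam \<in> {0<..1} \<Longrightarrow> mu \<in> {0<..1} \<Longrightarrow>
           norm (Phi J lam x - Phi J mu x) \<le> \<bar>lam - mu\<bar> * (C + norm x)"
    and u: "solves_cauchy J 0 u0 u"
    and L: "L = 2 * (norm u0 + norm (J 0)) + \<bar>C\<bar>"
    and t: "t \<ge> 0"
  shows "real n * norm (u t - v_iter J n) \<le> L * dev (real n) (1 + t) * (1 + ln (1 + t))"
  using t
proof (induction n arbitrary: t)
  case 0
  then show ?case using dev_pos[of "1 + t" 0] by (simp add: L)
next
  case (Suc n)
  define N where "N = real (Suc n)"
  have N: "N \<ge> 1" "N > 0" "real n = N - 1" by (auto simp: N_def)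
  define v where "v = v_iter J (Suc n)"
  have L0: "L \<ge> 0" by (simp add: L)
  \<comment> \<open>The derivative of the claimed bound.\<close>
  define \<psi>' where "\<psi>' = (\<lambda>t. L * ((1 - 2 * (N - (1 + t))) / (2 * dev N (1 + t))) * (1 + ln (1 + t))
      + L * dev N (1 + t) / (1 + t))"
  show ?case unfolding N_def[symmetric] v_def[symmetric]
  proof (rule field_le_epsilon)
    fix \<eta> :: real assume \<eta>: "\<eta> > 0"
    show "N * norm (u t - v) \<le> L * dev N (1 + t) * (1 + ln (1 + t)) + \<eta>"
    proof (rule comparison_right_slope[where a = 0 and f = "\<lambda>t. N * norm (u t - v)" and y' = \<psi>'])
      show "continuous_on {0..} (\<lambda>t. N * norm (u t - v))"
        by (intro continuous_intros solves_cauchy_continuous[OF u])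
    next
      fix s :: real assume s: "0 \<le> s"
      have "((\<lambda>s. dev N (1 + s)) has_real_derivative
          (1 - 2 * (N - (1 + s))) / (2 * dev N (1 + s))) (at s)"
        using dev_deriv[of "s + 1" N] s unfolding DERIV_shift by (simp add: add.commute)
      then show "((\<lambda>t. L * dev N (1 + t) * (1 + ln (1 + t)) + \<eta>) has_real_derivative \<psi>' s) (at s)"
        unfolding \<psi>'_def using s by (auto intro!: derivative_eq_intros)
    next
      have "norm (u 0 - v) \<le> norm u0 + norm (J 0)"
        using u norm_v_iter_le[OF J, of "Suc n"] norm_triangle_ineq4[of u0 v]
        by (auto simp: solves_cauchy_def v_def)
      then have "N * norm (u 0 - v) \<le> N * (norm u0 + norm (J 0))"
        using N by (intro mult_left_mono) auto
      also have "N / 2 \<le> dev N 1"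
        unfolding dev_def
      proof (rule real_le_rsqrt)
        have "(N - 1)\<^sup>2 + 1 - (N / 2)\<^sup>2 = 3 / 4 * (N - 4 / 3)\<^sup>2 + 2 / 3"
          by (simp add: power2_eq_square field_simps)
        also have "\<dots> \<ge> 0" by simp
        finally show "(N / 2)\<^sup>2 \<le> (N - 1)\<^sup>2 + 1" by simp
      qed
      then have "N * (norm u0 + norm (J 0)) \<le> 2 * dev N 1 * (norm u0 + norm (J 0))"
        by (intro mult_right_mono) auto
      also have "\<dots> \<le> L * dev N 1"
        using dev_pos[of 1 N] by (simp add: L algebra_simps)
      finally show "N * norm (u 0 - v) \<le> L * dev N (1 + 0) * (1 + ln (1 + 0)) + \<eta>"
        using \<eta> by simp
    next
      fix s :: real
      assume s: "0 \<le> s" and eq: "N * norm (u s - v) = L * dev N (1 + s) * (1 + ln (1 + s)) + \<eta>"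
      define x where "x = 1 + s"
      have x: "x \<ge> 1" "x > 0" "ln x \<ge> 0" using s by (auto simp: x_def)
      define E where "E = (1 - 2 * (N - x)) / (2 * dev N x)"
      have \<psi>': "\<psi>' s = L * E * (1 + ln x) + L * dev N x / x"
        by (simp add: \<psi>'_def E_def x_def)
      define p where "p = Phi J ((1 + s) powr (0 - 1)) (u s)"
      have p: "p = Phi J (1 / x) (u s)"
        using x by (simp add: p_def x_def powr_minus_divide)
      \<comment> \<open>Passing from \<open>1 / x\<close> to \<open>1 / N\<close> at \<open>u s\<close> leaves the contraction factor \<open>1 - 1 / N\<close>, which
        turns the weight \<open>N\<close> into \<open>N - 1\<close> and so matches the induction hypothesis.\<close>
      have "norm (p - v) \<le> norm (p - Phi J (1 / N) (u s)) + norm (Phi J (1 / N) (u s) - v)"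
        using norm_triangle_ineq[of "p - Phi J (1 / N) (u s)" "Phi J (1 / N) (u s) - v"] by simp
      also have "\<dots> \<le> \<bar>1 / x - 1 / N\<bar> * (C + norm (u s)) + (1 - 1 / N) * norm (u s - v_iter J n)"
        unfolding p v_def v_iter_Suc N_def[symmetric]
        using x N by (intro add_mono Phi norm_Phi_diff_le[OF J]) auto
      also have "\<bar>1 / x - 1 / N\<bar> * (C + norm (u s)) \<le> \<bar>1 / x - 1 / N\<bar> * L"
      proof (rule mult_left_mono)
        show "C + norm (u s) \<le> L"
          using solves_cauchy_bounded[OF J u zero_le_one s] norm_ge_zero[of u0] norm_ge_zero[of "J 0"] abs_ge_self[of C]
          unfolding L by argo
      qed simp
      finally have "N * norm (p - v) \<le> N * (\<bar>1 / x - 1 / N\<bar> * L + (1 - 1 / N) * norm (u s - v_iter J n))"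
        using N by (intro mult_left_mono) auto
      also have "\<dots> = L * (N * \<bar>1 / x - 1 / N\<bar>) + (N - 1) * norm (u s - v_iter J n)"
        using N by (simp add: field_simps)
      also have "N * \<bar>1 / x - 1 / N\<bar> = \<bar>N * (1 / x - 1 / N)\<bar>"
        using N by (simp add: abs_mult)
      also have "N * (1 / x - 1 / N) = (N - x) / x"
        using N x by (simp add: field_simps)
      also have "\<bar>(N - x) / x\<bar> = \<bar>N - x\<bar> / x" using x by simp
      also have "L * (\<bar>N - x\<bar> / x) \<le> L * (dev N x / x)"
        using abs_le_dev[of x N] x L0 by (intro mult_left_mono divide_right_mono) auto
      also have "(N - 1) * norm (u s - v_iter J n) \<le> L * dev (N - 1) x * (1 + ln x)"
        using Suc.IH[OF s] by (simp add: N x_def)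
      also have "L * dev (N - 1) x * (1 + ln x)
          \<le> L * (dev N x + E) * (1 + ln x)"
        using dev_step[of x N] x L0 by (intro mult_right_mono mult_left_mono) (auto simp: E_def)
      finally have "N * norm (p - v) \<le> \<psi>' s + L * dev N x * (1 + ln x)"
        by (simp add: \<psi>' algebra_simps)
      then have "N * (norm (p - v) - norm (u s - v)) < \<psi>' s"
        using eq \<eta> by (simp add: x_def algebra_simps)
      then have "norm (p - v) - norm (u s - v) < \<psi>' s / N"
        using N by (simp add: field_simps)
      then obtain m where m: "norm (p - v) - norm (u s - v) < m" "m < \<psi>' s / N"
        using dense by blast
      have "eventually (\<lambda>h. norm (u (s + h) - v) \<le> norm (u s - v) + h * m) (at_right 0)"
        using norm_right_slope[OF solves_cauchy_deriv[OF u s] s] m unfolding p_def by simp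
      then have "eventually (\<lambda>h. N * norm (u (s + h) - v) \<le> N * norm (u s - v) + h * (N * m)) (at_right 0)"
      proof eventually_elim
        case (elim h)
        then show ?case using mult_left_mono[OF elim, of N] N by (simp add: algebra_simps)
      qed
      moreover have "N * m < \<psi>' s" using m N by (simp add: field_simps)
      ultimately show "\<exists>m<\<psi>' s. eventually (\<lambda>h. N * norm (u (s + h) - v) \<le> N * norm (u s - v) + h * m) (at_right 0)"
        by blast
    qed (use Suc.prems in auto)
  qed
qed

lemma solves_cauchy_minus_v_iter:
  fixes J :: "'a::banach \<Rightarrow> 'a"
  assumes J: "1-lipschitz_on UNIV J"
    and Phi: "\<And>x lam mu. lam \<in> {0<..1} \<Longrightarrow> mu \<in> {0<..1} \<Longrightarrow>
           norm (Phi J lam x - Phi J mu x) \<le> \<bar>lam - mu\<bar> * (C + norm x)"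
    and u: "solves_cauchy J 0 u0 u"
  shows "((\<lambda>t. u t - v_iter J (nat \<lfloor>t\<rfloor>)) \<longlongrightarrow> 0) at_top"
proof -
  define L where "L = 2 * (norm u0 + norm (J 0)) + \<bar>C\<bar>"
  have L0: "L \<ge> 0" by (simp add: L_def)
  have "((\<lambda>t. L * sqrt (t + 5) * (1 + ln (1 + t)) / (t - 1)) \<longlongrightarrow> 0) at_top"
    by real_asymp
  moreover have "eventually (\<lambda>t. norm (u t - v_iter J (nat \<lfloor>t\<rfloor>))
      \<le> L * sqrt (t + 5) * (1 + ln (1 + t)) / (t - 1)) at_top"
    using eventually_gt_at_top[of 1]
  proof eventually_elim
    case (elim t)
    define n where "n = nat \<lfloor>t\<rfloor>"
    have n: "real n \<le> t" "t - 1 \<le> real n" using elim by (simp_all add: n_def)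
    have "(t - 1) * norm (u t - v_iter J n) \<le> real n * norm (u t - v_iter J n)"
      using n by (intro mult_right_mono) auto
    also have "\<dots> \<le> L * dev (real n) (1 + t) * (1 + ln (1 + t))"
      using elim by (intro v_iter_estimate[OF J Phi u L_def]) auto
    also have "\<dots> \<le> L * sqrt (t + 5) * (1 + ln (1 + t))"
    proof (intro mult_right_mono mult_left_mono)
      have "\<bar>real n - (1 + t)\<bar> \<le> 2" using n by linarith
      then have "(real n - (1 + t))\<^sup>2 \<le> 2\<^sup>2" by (metis abs_numeral abs_le_square_iff)
      then show "dev (real n) (1 + t) \<le> sqrt (t + 5)" by (simp add: dev_def)
    qed (use elim L0 in auto)
    finally have "(t - 1) * norm (u t - v_iter J n) \<le> L * sqrt (t + 5) * (1 + ln (1 + t))" .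
    then show ?case using elim by (simp add: n_def pos_le_divide_eq mult.commute)
  qed
  ultimately show ?thesis by (rule Lim_null_comparison[rotated])
qed

section \<open>Equivalence of the limits\<close>

theorem corollary4p19:
  fixes J :: "'a::banach \<Rightarrow> 'a" and C :: real and u0 l :: 'a and u :: "real \<Rightarrow> real \<Rightarrow> 'a"
  assumes "1-lipschitz_on UNIV J"
    and "\<forall>x. \<forall>lam\<in>{0<..1}. \<forall>mu\<in>{0<..1}.
           norm (Phi J lam x - Phi J mu x) \<le> \<bar>lam - mu\<bar> * (C + norm x)"
    and "\<forall>\<alpha>\<in>{0..<1}. solves_cauchy J \<alpha> u0 (u \<alpha>)"
  shows "((u 0 \<longlongrightarrow> l) at_top \<longleftrightarrow> v_iter J \<longlonglongrightarrow> l) \<and>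
         (\<forall>\<alpha>\<in>{0<..<1}. (u \<alpha> \<longlongrightarrow> l) at_top \<longleftrightarrow> (v_disc J \<longlongrightarrow> l) (at_right 0))"
proof (intro conjI ballI)
  note J = assms(1)
  have Phi: "norm (Phi J lam x - Phi J mu x) \<le> \<bar>lam - mu\<bar> * (C + norm x)"
    if "lam \<in> {0<..1}" "mu \<in> {0<..1}" for x lam mu
    using assms(2) that by blast
  have u: "solves_cauchy J \<alpha> u0 (u \<alpha>)" if "0 \<le> \<alpha>" "\<alpha> < 1" for \<alpha>
    using assms(3) that by simp
  have lim0: "((\<lambda>t. u 0 t - v_iter J (nat \<lfloor>t\<rfloor>)) \<longlongrightarrow> 0) at_top"
    by (rule solves_cauchy_minus_v_iter[OF J Phi u]) auto
  show "(u 0 \<longlongrightarrow> l) at_top \<longleftrightarrow> v_iter J \<longlonglongrightarrow> l"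
  proof
    assume "(u 0 \<longlongrightarrow> l) at_top"
    from tendsto_diff[OF this lim0] have "((\<lambda>t::real. v_iter J (nat \<lfloor>t\<rfloor>)) \<longlongrightarrow> l) at_top" by simp
    from filterlim_compose[OF this filterlim_real_sequentially] show "v_iter J \<longlonglongrightarrow> l" by simp
  next
    assume "v_iter J \<longlonglongrightarrow> l"
    from filterlim_compose[OF this filterlim_compose[OF filterlim_nat_sequentially filterlim_floor_sequentially]]
    have "((\<lambda>t::real. v_iter J (nat \<lfloor>t\<rfloor>)) \<longlongrightarrow> l) at_top" .
    from tendsto_add[OF lim0 this] show "(u 0 \<longlongrightarrow> l) at_top" by simp
  qed
  fix \<alpha> :: real assume "\<alpha> \<in> {0<..<1}"
  then have \<alpha>: "0 < \<alpha>" "\<alpha> < 1" by auto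
  have lim: "((\<lambda>t. u \<alpha> t - v_disc J ((1 + t) powr (\<alpha> - 1))) \<longlongrightarrow> 0) at_top"
    by (rule solves_cauchy_minus_v_disc[OF J Phi u]) (use \<alpha> in auto)
  show "(u \<alpha> \<longlongrightarrow> l) at_top \<longleftrightarrow> (v_disc J \<longlongrightarrow> l) (at_right 0)"
  proof
    assume "(u \<alpha> \<longlongrightarrow> l) at_top"
    from tendsto_diff[OF this lim]
    have w: "((\<lambda>t. v_disc J ((1 + t) powr (\<alpha> - 1))) \<longlongrightarrow> l) at_top" by simp
    \<comment> \<open>The inverse of the time change \<open>t \<mapsto> (1 + t) powr (\<alpha> - 1)\<close>.\<close>
    have "filterlim (\<lambda>x. x powr (1 / (\<alpha> - 1)) - 1) at_top (at_right (0::real))"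
      using \<alpha> by real_asymp
    from filterlim_compose[OF w this]
    have "((\<lambda>x. v_disc J ((x powr (1 / (\<alpha> - 1))) powr (\<alpha> - 1))) \<longlongrightarrow> l) (at_right 0)" by simp
    then show "(v_disc J \<longlongrightarrow> l) (at_right 0)"
    proof (rule Lim_transform_eventually)
      show "eventually (\<lambda>x. v_disc J ((x powr (1 / (\<alpha> - 1))) powr (\<alpha> - 1)) = v_disc J x) (at_right 0)"
        using eventually_at_right_less[of "0::real"]
        by eventually_elim (use \<alpha> in \<open>simp add: powr_powr\<close>)
    qed
  next
    assume v: "(v_disc J \<longlongrightarrow> l) (at_right 0)"
    have "filterlim (\<lambda>t. (1 + t) powr (\<alpha> - 1)) (at_right (0::real)) at_top"
      using \<alpha> by real_asymp
    from tendsto_add[OF lim filterlim_compose[OF v this]] show "(u \<alpha> \<longlongrightarrow> l) at_top" by simp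
  qed
qed

end
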